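(* Let $A, C \in \mathbb{F}_3[T]$ be nonzero polynomials with $\deg A > \deg C$ and such that $C$ divides $A$. Let $\beta \in \mathbb{F}_3((T^{-1}))$ be the irrational solution of $-\beta^{4} - A\beta + C = 0$ satisfying $|\beta| < 1$. Then the continued fraction expansion of $\beta$ is $\beta = [b_0, b_1, \ldots, b_n, \ldots]$ with $b_0 = 0$, $b_1 = A/C$, and for all $n \geq 2$, $$b_n = \left(\frac{A}{C}\right)^{3^{n-1}} C^{\frac{3^{n-1} + (-1)^n}{4}}.$$ Furthermore, $\nu(\beta) = 4$.
   Context: $\mathbb{F}_3$ is the field with three elements, $\mathbb{F}_3((T^{-1}))$ the field of formal power series in $1/T$, with the absolute value $|x| = |T|^{\deg x}$ extending $|P/Q| = |T|^{\deg P - \deg Q}$ on $\mathbb{F}_3(T)$, where $|T|>1$ is a fixed real number. Every irrational $x$ has a continued fraction expansion $x=[a_0,a_1,a_2,\ldots]$ with $a_i \in \mathbb{F}_3[T]$ and $\deg a_i > 0$ for $i \ge 1$. The irrationality measure (approximation exponent) of an irrational $x$ is $\nu(x) = -\limsup_{|Q|\to\infty} \log|x - P/Q| / \log|Q|$, where $P,Q \in \mathbb{F}_3[T]$.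
   Formalization: The irrationality measure is taken as limsup of −log|x−P/Q|/log|Q| as |Q|→∞, with the minus sign inside the limsup; as printed, with the sign outside and P arbitrary, ν(x) would be −∞ for every x. *)

theory Defs
  imports
    Complex_Main
    "HOL-Library.Cardinality"
    "HOL-Library.Extended_Real"
    "HOL-Computational_Algebra.Formal_Laurent_Series"
begin

text \<open>
  The field of formal power series in \<open>1/T\<close> over a field \<open>'a\<close> is rendered by the type \<open>'a fls\<close>
  whose indeterminate \<^term>\<open>fls_X\<close> stands for \<open>1/T\<close>; thus \<open>T\<close> itself is \<^term>\<open>fls_X_inv\<close>, and
  the degree in \<open>T\<close> of a nonzero series is the negative of its \<^const>\<open>fls_subdegree\<close>.
\<close>

definition poly_in_T :: "'a::field poly \<Rightarrow> 'a fls" where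
  "poly_in_T P = poly (map_poly fls_const P) fls_X_inv"

text \<open>The parameter \<open>t\<close> is the real number \<open>|T| > 1\<close>.\<close>

definition abs_T :: "real \<Rightarrow> 'a::field fls \<Rightarrow> real" where
  "abs_T t x = (if x = 0 then 0 else t powi (- fls_subdegree x))"

definition irrational_fls :: "'a::field fls \<Rightarrow> bool" where
  "irrational_fls x \<longleftrightarrow> (\<forall>P Q. Q \<noteq> 0 \<longrightarrow> x \<noteq> poly_in_T P / poly_in_T Q)"

text \<open>
  \<open>cfrac_convergent a n\<close> is the finite continued fraction \<open>[a 0, \<dots>, a n]\<close>. Division by zero
  is a totalised junk value, but it does not occur when all \<open>a i\<close> with \<open>i \<ge> 1\<close> have positive
  degree.
\<close>

fun cfrac_convergent :: "(nat \<Rightarrow> 'a::field poly) \<Rightarrow> nat \<Rightarrow> 'a fls" where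
  "cfrac_convergent a 0 = poly_in_T (a 0)"
| "cfrac_convergent a (Suc n) =
     poly_in_T (a 0) + 1 / cfrac_convergent (\<lambda>i. a (Suc i)) n"

definition has_cfrac_expansion :: "real \<Rightarrow> 'a::field fls \<Rightarrow> (nat \<Rightarrow> 'a poly) \<Rightarrow> bool" where
  "has_cfrac_expansion t x a \<longleftrightarrow>
     (\<forall>i\<ge>1. degree (a i) > 0) \<and>
     (\<lambda>n. abs_T t (x - cfrac_convergent a n)) \<longlonglongrightarrow> 0"

text \<open>
  The upper limit is taken over all pairs \<open>(P, Q)\<close> as \<open>|Q|\<close> tends to infinity, with no
  restriction on \<open>P\<close>. The minus sign has to stand inside the upper limit: since \<open>P\<close> may be a
  bad approximation, \<open>log |x - P/Q| / log |Q|\<close> itself is unbounded above for every \<open>x\<close>.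
  The value is an extended real because the exponent may be infinite.
\<close>

definition irrationality_measure :: "real \<Rightarrow> 'a::field fls \<Rightarrow> ereal" where
  "irrationality_measure t x =
     Limsup (filtercomap (\<lambda>(P, Q). abs_T t (poly_in_T Q)) at_top)
       (\<lambda>(P, Q). ereal (- ln (abs_T t (x - poly_in_T P / poly_in_T Q))
                        / ln (abs_T t (poly_in_T Q))))"

end

theory Submission
  imports Defs
begin

text \<open>
  The polynomials have characteristic 3. Rewriting the equation as \<open>1/\<beta> = A/C + \<beta>\<^sup>3/C\<close> shows that
  \<open>y\<^sub>1 = 1/\<beta>\<close> and \<open>y\<^sub>n\<^sub>+\<^sub>1 = C\<^sup>\<plusminus>\<^sup>1 y\<^sub>n\<^sup>3\<close> (with alternating exponents) are the complete quotients of
  \<open>\<beta>\<close>: cubing \<open>y\<^sub>n = b\<^sub>n + 1/y\<^sub>n\<^sub>+\<^sub>1\<close> gives the same relation at the next index.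

  The bound \<open>\<nu>(\<beta>) \<le> 4\<close> is Liouville's, for the form \<open>F(P,Q) = C Q\<^sup>4 - P (P\<^sup>3 + A Q\<^sup>3)\<close>. Conversely
  the Thue equation \<open>F(P,Q) = C\<close> has infinitely many solutions, obtained from \<open>(0,1)\<close> by
  iterating \<open>P/Q \<mapsto> C/(A + (P/Q)\<^sup>3)\<close> twice and cancelling \<open>C\<close>; at these the Liouville bound is
  attained up to the factor \<open>|C|\<close>.
\<close>

subsection \<open>Characteristic three\<close>

text \<open>Translation by 1 permutes the ring, so the sum of all elements equals itself plus
  \<open>CARD('a)\<close> copies of 1.\<close>

lemma three_eq_0_if_CARD_eq_3:
  assumes "CARD('a::ring_1) = 3"
  shows "(3 :: 'a) = 0"
proof -
  have fin: "finite (UNIV :: 'a set)"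
    using assms card.infinite by fastforce
  have "bij (\<lambda>x::'a. x + 1)"
    by (rule bij_betw_byWitness[where f' = "\<lambda>x. x - 1"]) auto
  then have "(\<Sum>x\<in>UNIV. x + 1) = (\<Sum>x\<in>UNIV. x :: 'a)"
    using sum.reindex_bij_betw[of "\<lambda>x::'a. x + 1" UNIV UNIV "\<lambda>x. x"] by simp
  then show ?thesis
    using assms by (simp add: sum.distrib)
qed

lemma
  fixes x y :: "'b::comm_ring_1"
  assumes "(3::'b) = 0"
  shows char3_add_cube: "(x + y) ^ 3 = x ^ 3 + y ^ 3"
    and char3_diff_cube: "(x - y) ^ 3 = x ^ 3 - y ^ 3"
proof -
  have "(x + y) ^ 3 = x ^ 3 + y ^ 3 + 3 * (x\<^sup>2 * y + x * y\<^sup>2)"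
    "(x - y) ^ 3 = x ^ 3 - y ^ 3 + 3 * (x * y\<^sup>2 - x\<^sup>2 * y)"
    by (simp_all add: algebra_simps power2_eq_square power3_eq_cube)
  then show "(x + y) ^ 3 = x ^ 3 + y ^ 3" "(x - y) ^ 3 = x ^ 3 - y ^ 3"
    using assms by simp_all
qed

lemma poly_three_eq_0: "(3::'a::comm_ring_1) = 0 \<Longrightarrow> (3::'a poly) = 0"
  by (metis numeral_poly pCons_0_0)

lemma fls_three_eq_0: "(3::'a::comm_ring_1) = 0 \<Longrightarrow> (3::'a fls) = 0"
  by (metis fls_const_numeral fls_const_0)

subsection \<open>Polynomials as Laurent series\<close>

lemma poly_in_T_0 [simp]: "poly_in_T 0 = 0"
  by (simp add: poly_in_T_def)

lemma poly_in_T_pCons: "poly_in_T (pCons a p) = fls_const a + fls_X_inv * poly_in_T p"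
  by (simp add: poly_in_T_def map_poly_pCons)

lemma poly_in_T_1 [simp]: "poly_in_T 1 = 1"
  by (simp add: one_pCons poly_in_T_pCons)

lemma poly_in_T_add [simp]: "poly_in_T (p + q) = poly_in_T p + poly_in_T q"
proof (induction p arbitrary: q)
  case (pCons a p)
  show ?case
    by (cases q) (simp add: poly_in_T_pCons pCons.IH flip: fls_plus_const, simp add: algebra_simps)
qed simp

lemma poly_in_T_smult: "poly_in_T (smult a p) = fls_const a * poly_in_T p"
  by (induction p) (simp_all add: poly_in_T_pCons algebra_simps)

lemma poly_in_T_mult [simp]: "poly_in_T (p * q) = poly_in_T p * poly_in_T q"
  by (induction p) (simp_all add: poly_in_T_pCons poly_in_T_smult algebra_simps)

lemma poly_in_T_power [simp]: "poly_in_T (p ^ n) = poly_in_T p ^ n"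
  by (induction n) simp_all

lemma poly_in_T_diff [simp]: "poly_in_T (p - q) = poly_in_T p - poly_in_T q"
  using poly_in_T_add[of "p - q" q] by (simp add: algebra_simps)

subsection \<open>The absolute value\<close>

lemma abs_T_0 [simp]: "abs_T t 0 = 0"
  by (simp add: abs_T_def)

lemma abs_T_1 [simp]: "abs_T t 1 = 1"
  by (simp add: abs_T_def)

lemma abs_T_minus [simp]: "abs_T t (- x) = abs_T t x"
  by (simp add: abs_T_def)

lemma abs_T_minus_commute: "abs_T t (x - y) = abs_T t (y - x)"
  using abs_T_minus[of t "y - x"] by simp

context
  fixes t :: real
  assumes t: "1 < t"
begin

lemma abs_T_eq_0_iff [simp]: "abs_T t x = 0 \<longleftrightarrow> x = 0"
  using t by (simp add: abs_T_def)

lemma abs_T_nonneg [simp]: "0 \<le> abs_T t x"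
  using t by (simp add: abs_T_def)

lemma abs_T_pos_iff [simp]: "0 < abs_T t x \<longleftrightarrow> x \<noteq> 0"
  using abs_T_nonneg[of x] abs_T_eq_0_iff[of x] by linarith

lemma abs_T_mult [simp]: "abs_T t (x * y) = abs_T t x * abs_T t y"
  using t by (auto simp: abs_T_def power_int_add[symmetric])

lemma abs_T_power [simp]: "abs_T t (x ^ n) = abs_T t x ^ n"
  by (induction n) simp_all

lemma abs_T_divide [simp]: "abs_T t (x / y) = abs_T t x / abs_T t y"
proof (cases "y = 0")
  case False
  then have "abs_T t x = abs_T t (x / y) * abs_T t y"
    by (simp flip: abs_T_mult)
  with False show ?thesis
    by simp
qed simp

lemma abs_T_add_le_max: "abs_T t (x + y) \<le> max (abs_T t x) (abs_T t y)"
proof (cases "x = 0 \<or> y = 0 \<or> x + y = 0")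
  case True
  then show ?thesis
    by (auto simp: le_max_iff_disj)
next
  case False
  then have "min (fls_subdegree x) (fls_subdegree y) \<le> fls_subdegree (x + y)"
    by (simp add: fls_plus_subdegree)
  then have "fls_subdegree x \<le> fls_subdegree (x + y) \<or> fls_subdegree y \<le> fls_subdegree (x + y)"
    by linarith
  with False t show ?thesis
    by (auto simp: abs_T_def le_max_iff_disj intro: power_int_increasing)
qed

text \<open>Writing \<open>x\<close> as (x + y) - y, a sum smaller than \<open>x\<close> would
  contradict the ultrametric inequality.\<close>

lemma abs_T_add_eq:
  assumes "abs_T t y < abs_T t x"
  shows "abs_T t (x + y) = abs_T t x"
  using abs_T_add_le_max[of x y] abs_T_add_le_max[of "x + y" "- y"] assms
  by (simp add: max_def split: if_splits)

text \<open>Induction along the Horner form: a constant has absolute value at most 1 and is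
  dominated by \<open>T\<close> times any nonzero polynomial.\<close>

lemma abs_T_poly_in_T:
  assumes "p \<noteq> 0"
  shows "abs_T t (poly_in_T p) = t ^ degree p"
  using assms
proof (induction p)
  case (pCons a p)
  have const: "abs_T t (fls_const a) \<le> 1"
    by (simp add: abs_T_def)
  have X: "abs_T t (fls_X_inv :: 'a fls) = t"
    by (simp add: abs_T_def)
  show ?case
  proof (cases "p = 0")
    case True
    with pCons.hyps show ?thesis
      by (simp add: poly_in_T_pCons abs_T_def)
  next
    case False
    have "1 < t ^ Suc (degree p)"
      using t by (rule one_less_power) simp
    then have "abs_T t (fls_X_inv * poly_in_T p + fls_const a) = t ^ Suc (degree p)"
      using const X pCons.IH[OF False] by (subst abs_T_add_eq) simp_all
    with False show ?thesis
      by (simp add: poly_in_T_pCons add.commute)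
  qed
qed simp

lemma poly_in_T_eq_0_iff [simp]: "poly_in_T p = 0 \<longleftrightarrow> p = 0"
  using abs_T_poly_in_T[of p] t by (metis abs_T_eq_0_iff power_not_zero not_one_less_zero poly_in_T_0)

text \<open>Integrality: this lower bound drives the Liouville argument.\<close>

lemma abs_T_poly_in_T_ge_1: "p \<noteq> 0 \<Longrightarrow> 1 \<le> abs_T t (poly_in_T p)"
  using t by (simp add: abs_T_poly_in_T one_le_power)

lemma abs_T_poly_in_T_ge: "degree p > 0 \<Longrightarrow> t \<le> abs_T t (poly_in_T p)"
  using t power_increasing[of 1 "degree p" t] by (cases "p = 0") (simp_all add: abs_T_poly_in_T)

subsection \<open>Continued fractions from complete quotients\<close>

text \<open>Inversion contracts: 1/u - 1/v = (v - u)/(uv), so for u, v of equal absolute value at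
  least \<open>t\<close> the error shrinks by a factor of at least \<open>t\<close>^2, of which one
  \<open>t\<close> is kept. The induction generalises over \<open>y\<close> and \<open>a\<close>
  because it shifts both.\<close>

lemma abs_T_diff_cfrac_convergent_le:
  fixes a :: "nat \<Rightarrow> 'a::field poly"
  assumes "\<And>n. y n = poly_in_T (a n) + 1 / y (Suc n)"
    and "\<And>n. t \<le> abs_T t (y (Suc n))"
  shows "abs_T t (y 0 - cfrac_convergent a n) \<le> (1 / t) ^ Suc n"
  using assms
proof (induction n arbitrary: y a)
  case 0
  have "y 0 - cfrac_convergent a 0 = 1 / y 1"
    using 0(1)[of 0] by simp
  then have "abs_T t (y 0 - cfrac_convergent a 0) = 1 / abs_T t (y 1)"
    by simp
  also have "\<dots> \<le> 1 / t"
    using 0(2)[of 0] t by (intro frac_le) auto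
  finally show ?case
    by simp
next
  case (Suc n)
  define c where "c = cfrac_convergent (\<lambda>i. a (Suc i)) n"
  have ge: "t \<le> abs_T t (y 1)"
    using Suc.prems(2)[of 0] by simp
  have err: "abs_T t (y 1 - c) \<le> (1 / t) ^ Suc n"
    unfolding c_def
    using Suc.IH[of "\<lambda>i. y (Suc i)" "\<lambda>i. a (Suc i)", OF Suc.prems(1) Suc.prems(2)]
    by (simp only: One_nat_def)
  have "(1 / t) ^ Suc n \<le> 1"
    using t by (intro power_le_one) auto
  \<comment> \<open>The tail error is at most 1, below the size of \<open>y 1\<close>, so
    \<open>c\<close> has the same absolute value and is nonzero.\<close>
  then have "abs_T t (c - y 1) < abs_T t (y 1)"
    using err ge t abs_T_minus_commute[of t c "y 1"] by linarith
  then have c: "abs_T t c = abs_T t (y 1)"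
    using abs_T_add_eq[of "c - y 1" "y 1"] by simp
  have nz: "y 1 \<noteq> 0" "c \<noteq> 0"
    using ge c t by (metis abs_T_0 not_one_less_zero order_less_le_trans)+
  have "y 0 - cfrac_convergent a (Suc n) = 1 / y 1 - 1 / c"
    using Suc.prems(1)[of 0] by (simp add: c_def)
  also have "\<dots> = (c - y 1) / (y 1 * c)"
    using nz by (simp add: diff_frac_eq)
  finally have "abs_T t (y 0 - cfrac_convergent a (Suc n))
      = abs_T t (y 1 - c) / (abs_T t (y 1) * abs_T t (y 1))"
    using c by (simp add: abs_T_minus_commute)
  also have "\<dots> \<le> (1 / t) ^ Suc n / t"
  proof (rule frac_le)
    have "t * 1 \<le> abs_T t (y 1) * abs_T t (y 1)"
      using ge t by (intro mult_mono) auto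
    then show "t \<le> abs_T t (y 1) * abs_T t (y 1)"
      by simp
  qed (use err t in auto)
  finally show ?case
    by simp
qed

text \<open>Index 0 is exempt from the size conditions, since the polynomial part of a series may be
  constant. From index 1 on, positive degree makes every complete quotient at least \<open>t\<close>
  in absolute value, so the error decays geometrically.\<close>

lemma has_cfrac_expansion_complete_quotients:
  fixes a :: "nat \<Rightarrow> 'a::field poly"
  assumes deg: "\<And>n. degree (a (Suc n)) > 0"
    and y: "\<And>n. y n = poly_in_T (a n) + 1 / y (Suc n)"
    and abs: "\<And>n. abs_T t (y (Suc n)) = abs_T t (poly_in_T (a (Suc n)))"
  shows "has_cfrac_expansion t (y 0) a"
  unfolding has_cfrac_expansion_def
proof (intro conjI allI impI)
  show "degree (a i) > 0" if "1 \<le> i" for i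
    using deg[of "i - 1"] that by simp
  have "abs_T t (y 0 - cfrac_convergent a n) \<le> (1 / t) ^ Suc n" for n
  proof (rule abs_T_diff_cfrac_convergent_le[of y a, OF y])
    show "t \<le> abs_T t (y (Suc n))" for n
      using abs_T_poly_in_T_ge[OF deg] by (simp only: abs)
  qed
  moreover have "(\<lambda>n. (1 / t) ^ Suc n) \<longlonglongrightarrow> 0"
    using t by (intro LIMSEQ_Suc LIMSEQ_power_zero) simp
  ultimately show "(\<lambda>n. abs_T t (y 0 - cfrac_convergent a n)) \<longlonglongrightarrow> 0"
    using real_tendsto_sandwich[of "\<lambda>_. 0" "\<lambda>n. abs_T t (y 0 - cfrac_convergent a n)"
        sequentially "\<lambda>n. (1 / t) ^ Suc n" 0]
    by (simp only: abs_T_nonneg always_eventually tendsto_const simp_thms)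
qed

subsection \<open>The irrationality measure\<close>

text \<open>Taking logarithms in \<open>bound\<close> makes the quotient at most d + |ln K| / ln |Q|
  for large |Q|, which tends to d.\<close>

lemma irrationality_measure_le:
  fixes x :: "'a::field fls"
  assumes irr: "irrational_fls x" and "0 < K"
    and bound: "\<And>P Q. Q \<noteq> 0 \<Longrightarrow>
      1 \<le> K * abs_T t (poly_in_T Q) ^ d * abs_T t (x - poly_in_T P / poly_in_T Q)"
  shows "irrationality_measure t x \<le> ereal d"
  unfolding irrationality_measure_def Limsup_le_iff
proof (intro allI impI)
  fix z :: ereal
  assume "ereal d < z"
  \<comment> \<open>\<open>z\<close> may be infinite, so the estimate is made against a real number
    in between.\<close>
  then obtain s where s: "real d < s" "ereal s \<le> z"
    using ereal_dense2[of "ereal d" z] by (auto intro: less_imp_le)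
  \<comment> \<open>Beyond this threshold |ln K| < (s - d) ln |Q|; the extra 1 makes this strict and
    ln |Q| positive.\<close>
  define N where "N = exp (\<bar>ln K\<bar> / (s - d) + 1)"
  have *: "- ln (abs_T t (x - poly_in_T P / poly_in_T Q)) / ln (abs_T t (poly_in_T Q)) < s"
    if "N \<le> abs_T t (poly_in_T Q)" for P Q :: "'a poly"
  proof -
    define q where "q = abs_T t (poly_in_T Q)"
    define e where "e = abs_T t (x - poly_in_T P / poly_in_T Q)"
    have "0 < N"
      by (simp add: N_def)
    with that have "0 < q"
      unfolding q_def by linarith
    then have "Q \<noteq> 0"
      unfolding q_def by (metis abs_T_0 poly_in_T_0 less_irrefl)
    have "ln N \<le> ln q"
      using that \<open>0 < N\<close> \<open>0 < q\<close> by (subst ln_le_cancel_iff) (simp_all only: q_def)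
    then have lnq: "\<bar>ln K\<bar> / (s - d) < ln q"
      by (simp add: N_def)
    then have lnq_pos: "0 < ln q"
      using s(1) by (smt (verit) divide_nonneg_nonneg)
    \<comment> \<open>Irrationality rules out e = 0, where \<open>ln\<close> has only a default
      value.\<close>
    have "0 < e"
      using irr \<open>Q \<noteq> 0\<close> by (simp add: irrational_fls_def e_def)
    have "0 \<le> ln (K * q ^ d * e)"
      using bound[OF \<open>Q \<noteq> 0\<close>] by (simp add: q_def e_def)
    also have "\<dots> = ln K + d * ln q + ln e"
      using \<open>0 < K\<close> \<open>0 < q\<close> \<open>0 < e\<close> by (simp add: ln_mult ln_realpow)
    finally have "- ln e \<le> \<bar>ln K\<bar> + d * ln q"
      by simp
    also have "\<dots> < s * ln q"
      using lnq s(1) by (simp add: field_simps)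
    finally have "- ln e / ln q < s"
      using lnq_pos by (simp only: pos_divide_less_eq)
    then show ?thesis
      by (simp add: q_def e_def)
  qed
  then show "\<forall>\<^sub>F w in filtercomap (\<lambda>(P, Q). abs_T t (poly_in_T Q)) at_top.
      (case w of (P, Q) \<Rightarrow> ereal (- ln (abs_T t (x - poly_in_T P / poly_in_T Q)) /
        ln (abs_T t (poly_in_T Q)))) < z"
    unfolding eventually_filtercomap_at_top_linorder
    using s(2) by (intro exI[of _ N]) (auto intro: less_le_trans[OF _ s(2)])
qed

text \<open>Were the upper limit below \<open>d\<close>, the quotient would be below
  \<open>d\<close> for all large |Q|, yet \<open>approx\<close> supplies fractions with |Q|
  arbitrarily large where it is at least \<open>d\<close>.\<close>

lemma irrationality_measure_ge:
  fixes x :: "'a::field fls"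
  assumes irr: "irrational_fls x"
    and approx: "\<And>N. \<exists>P Q. Q \<noteq> 0 \<and> N \<le> abs_T t (poly_in_T Q) \<and>
      abs_T t (poly_in_T Q) ^ d * abs_T t (x - poly_in_T P / poly_in_T Q) \<le> 1"
  shows "ereal d \<le> irrationality_measure t x"
proof (rule ccontr)
  assume "\<not> ?thesis"
  then have "irrationality_measure t x < ereal d"
    by simp
  from Limsup_lessD[OF this[unfolded irrationality_measure_def]] obtain N where
    N: "- ln (abs_T t (x - poly_in_T P / poly_in_T Q)) / ln (abs_T t (poly_in_T Q)) < d"
    if "N \<le> abs_T t (poly_in_T Q)" for P Q
    by (auto simp: eventually_filtercomap_at_top_linorder)
  \<comment> \<open>The bound 2 ensures ln |Q| > 0, so dividing by it preserves the
    inequality.\<close>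
  obtain P Q where PQ: "Q \<noteq> 0" "max N 2 \<le> abs_T t (poly_in_T Q)"
    "abs_T t (poly_in_T Q) ^ d * abs_T t (x - poly_in_T P / poly_in_T Q) \<le> 1"
    using approx by blast
  define q where "q = abs_T t (poly_in_T Q)"
  define e where "e = abs_T t (x - poly_in_T P / poly_in_T Q)"
  have "2 \<le> q"
    using PQ(2) by (simp add: q_def)
  have "0 < e"
    using irr PQ(1) by (simp add: irrational_fls_def e_def)
  have "ln (q ^ d * e) \<le> 0"
    using PQ(3) \<open>2 \<le> q\<close> \<open>0 < e\<close> unfolding q_def[symmetric] e_def[symmetric]
    by (subst ln_le_zero_iff) simp_all
  then have "d * ln q \<le> - ln e"
    using \<open>2 \<le> q\<close> \<open>0 < e\<close> by (simp add: ln_mult ln_realpow)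
  moreover have "0 < ln q"
    using \<open>2 \<le> q\<close> by simp
  ultimately have "d \<le> - ln e / ln q"
    by (simp only: pos_le_divide_eq)
  with N[of Q P] PQ(2) show False
    by (simp add: q_def e_def)
qed

end

subsection \<open>The quartic series\<close>

text \<open>The first iterate C/(A + (P/Q)^3) is Q^3/R, the second is P'/Q'. The hypothesis says Q^4
  - PR = 1, and Frobenius turns the new form into C (Q' Q^3 - C R^4)^3, where Q' Q^3 - C R^4 = (Q^4
  - PR)^3 = 1.\<close>

lemma thue_step:
  fixes A C P Q R :: "'b::idom"
  assumes three: "(3::'b) = 0" and "C \<noteq> 0"
    and R: "C * R = A * Q ^ 3 + P ^ 3"
    and F: "C * Q ^ 4 - P * (P ^ 3 + A * Q ^ 3) = C"
  defines "P' \<equiv> C * R ^ 3" and "Q' \<equiv> A * R ^ 3 + Q ^ 9"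
  shows "C * Q' ^ 4 - P' * (P' ^ 3 + A * Q' ^ 3) = C"
proof -
  note frob = char3_add_cube[OF three] char3_diff_cube[OF three]
  have "C * (Q ^ 4 - P * R) = C * 1"
  proof -
    have "C * (Q ^ 4 - P * R) = C * Q ^ 4 - P * (C * R)"
      by (simp add: right_diff_distrib mult.left_commute)
    also have "\<dots> = C"
      unfolding R using F by (simp only: add.commute)
    finally show ?thesis
      by simp
  qed
  then have unit: "Q ^ 4 - P * R = 1"
    using \<open>C \<noteq> 0\<close> by (metis mult_left_cancel)
  have "Q' * Q ^ 3 - C * R ^ 4 = A * R ^ 3 * Q ^ 3 + Q ^ 12 - R ^ 3 * (C * R)"
    unfolding Q'_def by algebra
  also have "\<dots> = (Q ^ 4) ^ 3 - (P * R) ^ 3"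
    unfolding R by algebra
  also have "\<dots> = 1"
    by (simp only: unit power_one flip: frob)
  finally have "(Q' * Q ^ 3) ^ 3 - (C * R ^ 4) ^ 3 = 1"
    by (simp flip: frob)
  moreover have "C * Q' ^ 4 - P' * (P' ^ 3 + A * Q' ^ 3) = C * ((Q' * Q ^ 3) ^ 3 - (C * R ^ 4) ^ 3)"
  proof -
    have "Q' ^ 4 = Q' ^ 3 * (A * R ^ 3 + Q ^ 9)"
      by (simp add: Q'_def numeral_eq_Suc)
    then show ?thesis
      unfolding P'_def by (simp add: algebra_simps power_mult_distrib flip: power_mult power_add)
  qed
  ultimately show ?thesis
    by simp
qed

text \<open>Each use of \<open>thue_step\<close> enlarges |Q|. The invariant \<open>C dvd P\<close>
  makes R a polynomial; |P| < |Q| identifies the dominant terms and places P/Q in the unit disc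
  together with the root.\<close>

lemma thue_solutions:
  fixes A C :: "'a::field poly"
  assumes three: "(3::'a) = 0" and t: "1 < t"
    and C: "C \<noteq> 0" and "C dvd A" and deg: "degree C < degree A"
  shows "\<exists>P Q. C dvd P \<and> C * Q ^ 4 - P * (P ^ 3 + A * Q ^ 3) = C \<and>
    abs_T t (poly_in_T P) < abs_T t (poly_in_T Q) \<and> t ^ m \<le> abs_T t (poly_in_T Q)"
proof (induction m)
  case 0
  show ?case
    by (intro exI[of _ 0] exI[of _ 1]) simp
next
  case (Suc m)
  then obtain P Q where PQ: "C dvd P" "C * Q ^ 4 - P * (P ^ 3 + A * Q ^ 3) = C"
    "abs_T t (poly_in_T P) < abs_T t (poly_in_T Q)" "t ^ m \<le> abs_T t (poly_in_T Q)"
    by blast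
  have "C dvd A * Q ^ 3 + P ^ 3"
    using \<open>C dvd A\<close> PQ(1) by (simp add: dvd_power_iff dvd_add dvd_trans power3_eq_cube)
  then obtain R where R: "C * R = A * Q ^ 3 + P ^ 3"
    by (metis dvdE)
  define N where "N p = abs_T t (poly_in_T p)" for p :: "'a poly"
  have N_mult: "N (p * q) = N p * N q" and N_power: "N (p ^ k) = N p ^ k"
    and N_nonneg: "0 \<le> N p" for p q k
    using t by (simp_all add: N_def)
  have N_add: "N (p + q) = N p" if "N q < N p" for p q
    using that t by (simp add: N_def abs_T_add_eq)
  have "A \<noteq> 0"
    using deg by auto
  have NC: "1 \<le> N C"
    using C t by (simp add: N_def abs_T_poly_in_T_ge_1)
  \<comment> \<open>The degree gap of at least 1 supplies the factor \<open>t\<close> by which |Q|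
    grows.\<close>
  have NA: "t * N C \<le> N A"
    using C \<open>A \<noteq> 0\<close> t deg power_increasing[of "Suc (degree C)" "degree A" t]
    by (simp add: N_def abs_T_poly_in_T)
  have NA1: "1 < N A" and NCA: "N C < N A"
    using NA NC t mult_strict_right_mono[of 1 t "N C"] by linarith+
  have NQ: "1 \<le> N Q"
    using PQ(4) one_le_power[of t m] t unfolding N_def by linarith
  \<comment> \<open>A Q^3 dominates P^3 in C R, so |C| |R| = |A| |Q|^3; with |C| < |A| this gives
    |Q|^3 < |R|.\<close>
  have "N P ^ 3 < N Q ^ 3"
    using PQ(3) N_nonneg by (intro power_strict_mono) (auto simp: N_def)
  also have "\<dots> \<le> N A * N Q ^ 3"
    using NA1 N_nonneg mult_right_mono[of 1 "N A"] by simp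
  finally have "N (A * Q ^ 3 + P ^ 3) = N A * N Q ^ 3"
    using N_add[of "P ^ 3" "A * Q ^ 3"] by (simp add: N_mult N_power)
  then have "N C * N R = N A * N Q ^ 3"
    by (simp flip: R N_mult)
  moreover have "N C * N Q ^ 3 < N A * N Q ^ 3"
    using NCA NQ by (intro mult_strict_right_mono) auto
  ultimately have NR: "N Q ^ 3 < N R"
    using NC by (metis mult_less_cancel_left_pos zero_less_one less_le_trans)
  define P' Q' where "P' = C * R ^ 3" and "Q' = A * R ^ 3 + Q ^ 9"
  have NQ3: "N Q \<le> N Q ^ 3"
    using NQ self_le_power[of "N Q" 3] by simp
  \<comment> \<open>The same domination one iterate later: A R^3 outweighs Q^9 in Q'.\<close>
  have "N (Q ^ 9) = (N Q ^ 3) ^ 3"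
    by (simp add: N_power flip: power_mult)
  also have "\<dots> < N R ^ 3"
    using NR N_nonneg by (intro power_strict_mono) auto
  also have "\<dots> \<le> N A * N R ^ 3"
    using NA1 N_nonneg mult_right_mono[of 1 "N A"] by simp
  finally have NQ': "N Q' = N A * N R ^ 3"
    unfolding Q'_def by (subst N_add) (simp_all add: N_mult N_power)
  have NR1: "1 < N R" and NRQ: "N Q \<le> N R"
    using NQ NQ3 NR by linarith+
  have R3: "N R \<le> N R ^ 3"
    using NR1 self_le_power[of "N R" 3] by simp
  have "C dvd P'"
    by (simp add: P'_def)
  moreover have "C * Q' ^ 4 - P' * (P' ^ 3 + A * Q' ^ 3) = C"
    unfolding P'_def Q'_def by (rule thue_step[OF poly_three_eq_0[OF three] C R PQ(2)])
  moreover have "N P' < N Q'"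
    using NCA NR1 by (simp add: P'_def NQ' N_mult N_power)
  moreover have "t ^ Suc m \<le> N Q'"
  proof -
    have "t * 1 \<le> N A"
      using NA NC t mult_left_mono[of 1 "N C" t] by linarith
    then have "t * t ^ m \<le> N A * N R ^ 3"
      using PQ(4) NRQ R3 t by (intro mult_mono) (auto simp: N_def)
    then show ?thesis
      by (simp add: NQ')
  qed
  ultimately show ?case
    unfolding N_def by blast
qed

section \<open>Size of the quartic form and the exponent 4\<close>

text \<open>For f(x) = c - a x - x^4 the left side is q^4 f(p/q); as f(\<beta>) = 0, the factor
  \<beta> - p/q splits off.\<close>

lemma quartic_diff_identity:
  fixes \<beta> x a c :: "'b::field"
  assumes "- (\<beta> ^ 4) - a * \<beta> + c = 0" and "q \<noteq> 0"
  shows "c * q ^ 4 - p * (p ^ 3 + a * q ^ 3)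
    = q ^ 4 * ((\<beta> - p / q) * (a + (\<beta> ^ 3 + (\<beta>\<^sup>2 * (p / q) + (\<beta> * (p / q)\<^sup>2 + (p / q) ^ 3)))))"
proof -
  define x where "x = p / q"
  have p: "p = x * q"
    using \<open>q \<noteq> 0\<close> by (simp add: x_def)
  have c: "c = \<beta> ^ 4 + a * \<beta>"
    using assms(1) by algebra
  show ?thesis
    unfolding x_def[symmetric] unfolding p c by algebra
qed

text \<open>The cofactor of \<beta> - P/Q is A plus terms of absolute value below 1 < |A|, so its
  size is exactly |A|. The equality serves both bounds on the exponent.\<close>

lemma abs_T_quartic_form:
  fixes A C P Q :: "'a::field poly"
  assumes t: "1 < t" and eq: "- (\<beta> ^ 4) - poly_in_T A * \<beta> + poly_in_T C = 0"
    and \<beta>: "abs_T t \<beta> < 1" and deg: "0 < degree A" and "Q \<noteq> 0"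
    and x: "abs_T t (poly_in_T P / poly_in_T Q) < 1"
  shows "abs_T t (poly_in_T (C * Q ^ 4 - P * (P ^ 3 + A * Q ^ 3)))
    = abs_T t (poly_in_T Q) ^ 4 * (abs_T t (\<beta> - poly_in_T P / poly_in_T Q) * abs_T t (poly_in_T A))"
proof -
  define x where "x = poly_in_T P / poly_in_T Q"
  have small: "abs_T t (u + v) < 1" if "abs_T t u < 1" "abs_T t v < 1" for u v :: "'a fls"
    using abs_T_add_le_max[OF t, of u v] that by linarith
  have lt: "abs_T t (u * v) < 1" if "abs_T t u < 1" "abs_T t v < 1" for u v :: "'a fls"
    using that mult_strict_mono[of "abs_T t u" 1 "abs_T t v" 1] t by simp
  have "abs_T t (\<beta> ^ 3 + (\<beta>\<^sup>2 * x + (\<beta> * x\<^sup>2 + x ^ 3))) < 1"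
    using \<beta> x unfolding x_def[symmetric] power2_eq_square power3_eq_cube by (intro small lt)
  also have "1 < abs_T t (poly_in_T A)"
    using abs_T_poly_in_T_ge[OF t deg] t by simp
  finally have "abs_T t (poly_in_T A + (\<beta> ^ 3 + (\<beta>\<^sup>2 * x + (\<beta> * x\<^sup>2 + x ^ 3))))
      = abs_T t (poly_in_T A)"
    by (rule abs_T_add_eq[OF t])
  then show ?thesis
    using quartic_diff_identity[OF eq, of "poly_in_T Q" "poly_in_T P"] \<open>Q \<noteq> 0\<close> t
    by (simp add: x_def)
qed

lemma irrationality_measure_quartic:
  fixes A C :: "'a::field poly"
  assumes three: "(3::'a) = 0" and t: "1 < t"
    and C: "C \<noteq> 0" and "C dvd A" and deg: "degree C < degree A"
    and irr: "irrational_fls \<beta>"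
    and eq: "- (\<beta> ^ 4) - poly_in_T A * \<beta> + poly_in_T C = 0"
    and \<beta>: "abs_T t \<beta> < 1"
  shows "irrationality_measure t \<beta> = 4"
proof (rule antisym)
  have "A \<noteq> 0" and "0 < degree A"
    using deg by auto
  define K where "K = abs_T t (poly_in_T A)"
  have K: "1 \<le> K"
    using \<open>A \<noteq> 0\<close> t by (simp add: K_def abs_T_poly_in_T_ge_1)
  note form = abs_T_quartic_form[OF t eq \<beta> \<open>0 < degree A\<close>, folded K_def]
  have "irrationality_measure t \<beta> \<le> ereal (real 4)"
  proof (rule irrationality_measure_le[OF t irr])
    show "0 < K"
      using K by simp
    show "1 \<le> K * abs_T t (poly_in_T Q) ^ 4 * abs_T t (\<beta> - poly_in_T P / poly_in_T Q)"
      if Q: "Q \<noteq> 0" for P Q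
    proof (cases "abs_T t (poly_in_T P / poly_in_T Q) < 1")
      case True
      have nz: "\<beta> - poly_in_T P / poly_in_T Q \<noteq> 0"
        using irr Q by (simp add: irrational_fls_def)
      \<comment> \<open>A zero would make a product of nonzero factors vanish in
        \<open>form\<close>; so integrality applies to the form.\<close>
      have "poly_in_T (C * Q ^ 4 - P * (P ^ 3 + A * Q ^ 3)) \<noteq> 0"
      proof
        assume "poly_in_T (C * Q ^ 4 - P * (P ^ 3 + A * Q ^ 3)) = 0"
        with form[OF Q True] have
          "abs_T t (poly_in_T Q) ^ 4 * (abs_T t (\<beta> - poly_in_T P / poly_in_T Q) * K) = 0"
          by (metis abs_T_0)
        then show False
          using nz Q K t by (simp only: mult_eq_0_iff power_eq_0_iff abs_T_eq_0_iff poly_in_T_eq_0_iff) simp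
      qed
      then have "1 \<le> abs_T t (poly_in_T (C * Q ^ 4 - P * (P ^ 3 + A * Q ^ 3)))"
        using abs_T_poly_in_T_ge_1[OF t] poly_in_T_0 by metis
      with form[OF Q True] show ?thesis
        by (simp add: mult_ac)
    next
      case False
      \<comment> \<open>Here P/Q is larger than \<beta>, so the distance is |P/Q| itself, at least
        1.\<close>
      define x where "x = poly_in_T P / poly_in_T Q"
      have "1 \<le> abs_T t x"
        using False by (simp add: x_def)
      with \<beta> have "abs_T t (\<beta> - x) = abs_T t x"
        using abs_T_add_eq[OF t, of "- \<beta>" x] abs_T_minus_commute[of t x \<beta>] by simp
      with \<open>1 \<le> abs_T t x\<close> have "1 \<le> abs_T t (\<beta> - x)"
        by simp
      moreover have "1 \<le> K * abs_T t (poly_in_T Q) ^ 4"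
        using K abs_T_poly_in_T_ge_1[OF t Q] mult_mono[of 1 K 1 "abs_T t (poly_in_T Q) ^ 4"]
        by (simp add: one_le_power)
      ultimately show ?thesis
        using mult_mono[of 1 "K * abs_T t (poly_in_T Q) ^ 4" 1 "abs_T t (\<beta> - x)"]
        by (simp add: x_def)
    qed
  qed
  then show "irrationality_measure t \<beta> \<le> 4"
    by simp
  have "ereal (real 4) \<le> irrationality_measure t \<beta>"
  proof (rule irrationality_measure_ge[OF t irr])
    fix N :: real
    obtain m where m: "N < t ^ m"
      using real_arch_pow[OF t] by blast
    obtain P Q where PQ: "C * Q ^ 4 - P * (P ^ 3 + A * Q ^ 3) = C"
      "abs_T t (poly_in_T P) < abs_T t (poly_in_T Q)" "t ^ m \<le> abs_T t (poly_in_T Q)"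
      using thue_solutions[OF three t C \<open>C dvd A\<close> deg] by blast
    have "0 < abs_T t (poly_in_T Q)"
      using PQ(3) t zero_less_power[of t m] by linarith
    then have Q: "Q \<noteq> 0"
      using t by auto
    have "abs_T t (poly_in_T P / poly_in_T Q) < 1"
      using PQ(2) t \<open>0 < abs_T t (poly_in_T Q)\<close> by simp
    \<comment> \<open>On these solutions |Q|^4 |\<beta> - P/Q| equals |C|/|A|, which is at most
      1.\<close>
    from form[OF Q this, unfolded PQ(1)] have
      "abs_T t (poly_in_T Q) ^ 4 * abs_T t (\<beta> - poly_in_T P / poly_in_T Q) * K
        = abs_T t (poly_in_T C)"
      by (simp add: mult_ac)
    also have "abs_T t (poly_in_T C) \<le> 1 * K"
      using C \<open>A \<noteq> 0\<close> t deg by (simp add: K_def abs_T_poly_in_T)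
    finally have "abs_T t (poly_in_T Q) ^ 4 * abs_T t (\<beta> - poly_in_T P / poly_in_T Q) \<le> 1"
      using K by (simp only: mult_le_cancel_right)
    with Q m PQ(3) show "\<exists>P Q. Q \<noteq> 0 \<and> N \<le> abs_T t (poly_in_T Q) \<and>
        abs_T t (poly_in_T Q) ^ 4 * abs_T t (\<beta> - poly_in_T P / poly_in_T Q) \<le> 1"
      by (intro exI[of _ P] exI[of _ Q]) auto
  qed
  then show "4 \<le> irrationality_measure t \<beta>"
    by simp
qed

section \<open>Exponents of C and the partial quotients\<close>

text \<open>From index 1 on the values are 0, 1, 2, 7, 20, ...; the initial 0 lets the general
  formula cover A/C as well.\<close>

definition quartic_exponent :: "nat \<Rightarrow> nat" where
  "quartic_exponent n = nat ((3 ^ (n - 1) + (-1) ^ n) div 4)"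

lemma quartic_exponent_1: "quartic_exponent 1 = 0"
  by (simp add: quartic_exponent_def)

text \<open>3 and -1 agree modulo 4, so the division is exact. The index \<open>Suc n\<close> avoids
  truncated subtraction and flips the sign.\<close>

lemma four_quartic_exponent: "4 * int (quartic_exponent (Suc n)) = 3 ^ n - (-1) ^ n"
proof -
  have "(4::int) dvd 3 ^ n - (-1) ^ n"
  proof (induction n)
    case (Suc n)
    have "(3::int) ^ Suc n - (-1) ^ Suc n = 3 * (3 ^ n - (-1) ^ n) + 4 * (-1) ^ n"
      by simp
    with Suc show ?case
      by (metis dvd_add dvd_mult dvd_triv_left)
  qed simp
  moreover have "(0::int) \<le> 3 ^ n - (-1) ^ n"
    using one_le_power[of "3::int" n] by (cases "even n") (auto simp: uminus_power_if)
  ultimately show ?thesis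
    by (simp add: quartic_exponent_def)
qed

text \<open>Cubing a partial quotient triples the exponent; the factor C or 1/C shifts it by one.
  The odd case is stated additively to stay within the naturals.\<close>

lemma quartic_exponent_Suc_Suc:
  "even n \<Longrightarrow> quartic_exponent (Suc (Suc n)) = 3 * quartic_exponent (Suc n) + 1"
  "odd n \<Longrightarrow> quartic_exponent (Suc (Suc n)) + 1 = 3 * quartic_exponent (Suc n)"
  using four_quartic_exponent[of n] four_quartic_exponent[of "Suc n"] by auto

lemma quartic_has_cfrac_expansion:
  fixes C D :: "'a::field poly"
  assumes three: "(3::'a) = 0" and t: "1 < t"
    and C: "C \<noteq> 0" and degD: "0 < degree D"
    and eq: "- (\<beta> ^ 4) - poly_in_T (C * D) * \<beta> + poly_in_T C = 0"
    and \<beta>: "abs_T t \<beta> < 1"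
  defines "b \<equiv> \<lambda>n. if n = 0 then 0 else D ^ 3 ^ (n - 1) * C ^ quartic_exponent n"
  shows "has_cfrac_expansion t \<beta> b"
proof -
  have "D \<noteq> 0"
    using degD by auto
  define c where "c = poly_in_T C"
  have c: "c \<noteq> 0"
    using C t by (simp add: c_def)
  \<comment> \<open>The alternation starts with \<open>c\<close> because the first remainder is
    \<beta>^3/c, whose inverse must be c (1/\<beta>)^3.\<close>
  define w where "w n = (if even n then c else 1 / c)" for n :: nat
  have w: "w n \<noteq> 0" "w (Suc n) * w n = 1" for n
    using c by (simp_all add: w_def)
  define y where "y = (\<lambda>n. case n of 0 \<Rightarrow> \<beta> | Suc k \<Rightarrow> rec_nat (1 / \<beta>) (\<lambda>k z. w k * z ^ 3) k)"
  have y: "y 0 = \<beta>" "y (Suc 0) = 1 / \<beta>" "y (Suc (Suc n)) = w n * y (Suc n) ^ 3" for n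
    by (simp_all add: y_def)
  have b_Suc: "poly_in_T (b (Suc (Suc n))) = w n * poly_in_T (b (Suc n)) ^ 3" for n
  proof -
    have D: "D ^ (3 * 3 ^ n) = (D ^ 3 ^ n) ^ 3"
      by (simp add: power_mult[symmetric] mult.commute)
    have power_mult_3: "C ^ (3 * k) = (C ^ k) ^ 3" for k
      by (simp add: power_mult[symmetric] mult.commute)
    show ?thesis
    proof (cases "even n")
      case True
      then have "b (Suc (Suc n)) = C * b (Suc n) ^ 3"
        by (simp add: b_def quartic_exponent_Suc_Suc(1) D power_mult_distrib power_mult_3 mult.left_commute)
      with True show ?thesis
        by (simp add: w_def c_def)
    next
      case False
      \<comment> \<open>Multiplying by C replaces a division of polynomials.\<close>
      then have "C * b (Suc (Suc n)) = D ^ 3 ^ Suc n * C ^ (quartic_exponent (Suc (Suc n)) + 1)"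
        by (simp add: b_def)
      also have "\<dots> = b (Suc n) ^ 3"
        by (simp only: quartic_exponent_Suc_Suc(2)[OF False])
          (simp add: b_def D power_mult_distrib power_mult_3)
      finally have "c * poly_in_T (b (Suc (Suc n))) = poly_in_T (b (Suc n)) ^ 3"
        by (metis c_def poly_in_T_mult poly_in_T_power)
      with False c show ?thesis
        by (simp add: w_def field_simps)
    qed
  qed
  have "\<beta> \<noteq> 0"
    using eq c by (auto simp: c_def)
  have b_1: "b (Suc 0) = D"
    by (simp add: b_def quartic_exponent_1[simplified])
  have "c = \<beta> * (c * poly_in_T D + \<beta> ^ 3)"
    using eq unfolding poly_in_T_mult c_def[symmetric] by algebra
  then have inv: "1 / \<beta> = poly_in_T D + \<beta> ^ 3 / c"
    using \<open>\<beta> \<noteq> 0\<close> c by (simp add: field_simps)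
  have y_b: "y (Suc n) = poly_in_T (b (Suc n)) + 1 / y (Suc (Suc n))" for n
  proof (induction n)
    case 0
    have "1 / y (Suc (Suc 0)) = \<beta> ^ 3 / c"
      by (simp add: y w_def power_one_over)
    with inv show ?case
      by (simp only: y(2) b_1)
  next
    case (Suc n)
    have "y (Suc (Suc n)) = w n * (poly_in_T (b (Suc n)) + 1 / y (Suc (Suc n))) ^ 3"
      using Suc y(3) by metis
    also have "\<dots> = poly_in_T (b (Suc (Suc n))) + w n / y (Suc (Suc n)) ^ 3"
      by (simp add: char3_add_cube[OF fls_three_eq_0[OF three]] b_Suc power_one_over distrib_left)
    also have "w n / y (Suc (Suc n)) ^ 3 = 1 / y (Suc (Suc (Suc n)))"
    proof -
      \<comment> \<open>Alternation turns the cubed remainder back into the inverse of the next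
        complete quotient.\<close>
      have "w n = 1 / w (Suc n)"
        using w(2)[of n] w(1)[of "Suc n"] by (simp add: eq_divide_eq mult.commute)
      then show ?thesis
        by (simp add: y(3)[of "Suc n"])
    qed
    finally show ?case .
  qed
  \<comment> \<open>Both sequences obey the same recursion, so only the start needs an argument:
    there D dominates \<beta>^3/c.\<close>
  have abs: "abs_T t (y (Suc n)) = abs_T t (poly_in_T (b (Suc n)))" for n
  proof (induction n)
    case 0
    have "abs_T t (\<beta> ^ 3 / c) < abs_T t (poly_in_T D)"
    proof -
      have "abs_T t \<beta> ^ 3 \<le> 1"
        using \<beta> t by (intro power_le_one) auto
      moreover have "1 \<le> abs_T t c"
        using C t by (simp add: c_def abs_T_poly_in_T_ge_1)
      ultimately have "abs_T t (\<beta> ^ 3 / c) \<le> 1"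
        using t by (simp add: divide_le_eq)
      also have "1 < abs_T t (poly_in_T D)"
        using abs_T_poly_in_T_ge[OF t degD] t by simp
      finally show ?thesis .
    qed
    then show ?case
      using inv abs_T_add_eq[OF t] by (simp add: y b_1 del: abs_T_divide)
  next
    case (Suc n)
    then show ?case
      using t by (simp add: y(3) b_Suc)
  qed
  have "has_cfrac_expansion t (y 0) b"
  proof (rule has_cfrac_expansion_complete_quotients[of t b y, OF t _ _ abs])
    show "degree (b (Suc n)) > 0" for n
      using C \<open>D \<noteq> 0\<close> degD by (simp add: b_def degree_mult_eq degree_power_eq)
    show "y n = poly_in_T (b n) + 1 / y (Suc n)" for n
      using y_b by (cases n) (simp_all add: y b_def)
  qed
  then show ?thesis
    by (simp add: y)
qed

theorem theorem4:
  fixes A C :: "'a::field poly" and \<beta> :: "'a fls" and t :: real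
  assumes "CARD('a) = 3"
    and "t > 1"
    and "A \<noteq> 0" and "C \<noteq> 0"
    and "degree A > degree C"
    and "C dvd A"
    and "irrational_fls \<beta>"
    and "- (\<beta> ^ 4) - poly_in_T A * \<beta> + poly_in_T C = 0"
    and "abs_T t \<beta> < 1"
  shows "(\<exists>b. has_cfrac_expansion t \<beta> b \<and> b 0 = 0 \<and> b 1 = A div C \<and>
           (\<forall>n\<ge>2. b n = (A div C) ^ (3 ^ (n - 1)) *
                         C ^ nat ((3 ^ (n - 1) + (-1) ^ n) div 4)))
         \<and> irrationality_measure t \<beta> = 4"
proof
  have three: "(3::'a) = 0"
    using assms(1) by (rule three_eq_0_if_CARD_eq_3)
  define D where "D = A div C"
  have A: "A = C * D"
    using \<open>C dvd A\<close> by (simp add: D_def)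
  \<comment> \<open>Degrees add in A = C D, and deg A > deg C.\<close>
  have "0 < degree D"
    using assms(3-5) by (auto simp: A degree_mult_eq)
  from quartic_has_cfrac_expansion[OF three assms(2,4) this assms(8)[unfolded A] assms(9)]
  show "\<exists>b. has_cfrac_expansion t \<beta> b \<and> b 0 = 0 \<and> b 1 = A div C \<and>
      (\<forall>n\<ge>2. b n = (A div C) ^ (3 ^ (n - 1)) * C ^ nat ((3 ^ (n - 1) + (-1) ^ n) div 4))"
    unfolding D_def[symmetric]
    by (intro exI conjI, assumption) (auto simp: quartic_exponent_def)
  show "irrationality_measure t \<beta> = 4"
    using irrationality_measure_quartic[OF three assms(2,4,6,5,7,8,9)] .
qed

end
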